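(* For complex $s$ with $\Re(s)>0$, $$\int_{0}^{\infty}\frac{\{x\}^2[x]x^{-s-1}}{x^2-[x]^2-\{x\}[x]}\,dx=\frac{1}{s(s+1)}\left(s\zeta(s+1)+(1-s)\zeta(s)\right).$$
   Context: $\{x\}$ denotes the fractional part and $[x]$ the integer part of $x$; $\zeta$ is the Riemann zeta function. *)

theory Defs
  imports "HOL-Complex_Analysis.Complex_Analysis"
begin

text \<open>
  The Riemann zeta function, i.e. the analytic continuation of the Dirichlet series
  \<open>\<Sum>n\<ge>1. n powr (-z)\<close> from \<open>Re z > 1\<close> to the complex plane without the pole at \<open>1\<close>.
  The continuation is evaluated at \<open>s\<close> in a punctured half-plane that contains \<open>s\<close>.
  These regions are nested, connected and open and meet \<open>Re z > 1\<close>, so for \<open>s \<noteq> 1\<close> the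
  value does not depend on \<open>c\<close> and \<open>f\<close>. The value at the pole is unspecified.
\<close>

definition zeta :: "complex \<Rightarrow> complex" where
  "zeta s = (THE v. \<exists>c f. c < Re s \<and> f holomorphic_on ({z. c < Re z} - {1}) \<and>
     (\<forall>z. c < Re z \<longrightarrow> 1 < Re z \<longrightarrow> f z = (\<Sum>n. of_nat (Suc n) powr (- z))) \<and>
     v = f s)"

text \<open>
  At the positive integers the quotient is \<open>0 / 0\<close>, which is \<open>0\<close> in HOL; they form a null set.
\<close>

definition frac_floor_integrand :: "complex \<Rightarrow> real \<Rightarrow> complex" where
  "frac_floor_integrand s x =
     of_real ((frac x)\<^sup>2 * of_int \<lfloor>x\<rfloor>) * of_real x powr (- s - 1) /
     of_real (x\<^sup>2 - (of_int \<lfloor>x\<rfloor>)\<^sup>2 - frac x * of_int \<lfloor>x\<rfloor>)"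

end

theory Submission imports Defs begin

text \<open>
  On \<open>[N, N + 1)\<close> the denominator factors as \<open>{x} x\<close>, so the integrand is \<open>N (x - N) x powr (- s - 2)\<close>,
  of modulus at most \<open>N powr (- Re s - 1)\<close>. Hence the integral is a series of explicit terms that converges
  locally uniformly on \<open>Re s > 0\<close>, with a holomorphic sum \<open>F\<close>. For \<open>Re s > 1\<close> telescoping
  evaluates it by the Dirichlet series of \<open>\<zeta>(s)\<close> and \<open>\<zeta>(s + 1)\<close>. Solving this identity for
  \<open>\<zeta>(s)\<close> provides the analytic continuation to \<open>Re s > 0\<close>, where the formula therefore persists.
\<close>

section \<open>The Dirichlet series and the integral cut at the integers\<close>

definition dirichlet_zeta :: "complex \<Rightarrow> complex" where
  "dirichlet_zeta s = (\<Sum>n. of_nat (Suc n) powr (- s))"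

text \<open>Half-open intervals keep the pieces disjoint, so at most one is nonzero at any point.
  Indexing by \<open>Suc n\<close> leaves out \<open>(0, 1)\<close>, where the integer part and
  hence the integrand vanish.\<close>

definition frac_floor_piece :: "complex \<Rightarrow> nat \<Rightarrow> real \<Rightarrow> complex" where
  "frac_floor_piece s n x = indicator {real (Suc n)..<real (Suc n) + 1} x *\<^sub>R
     (of_real (real (Suc n) * (x - real (Suc n))) * of_real x powr (- s - 2))"

text \<open>With \<open>N = Suc n\<close> this is the integral of
  \<open>N * x powr (- s - 1) - N^2 * x powr (- s - 2)\<close> over \<open>[N, N + 1]\<close>, that
  is, of the expanded piece.\<close>

definition frac_floor_term :: "complex \<Rightarrow> nat \<Rightarrow> complex" where
  "frac_floor_term s n = of_nat (Suc n) *
     ((of_nat (Suc n) powr (- s) - of_nat (Suc (Suc n)) powr (- s)) / s -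
      of_nat (Suc n) * (of_nat (Suc n) powr (- s - 1) - of_nat (Suc (Suc n)) powr (- s - 1)) / (s + 1))"

section \<open>Powers of integers and holomorphic series on half-planes\<close>

lemma summable_Suc_powr:
  fixes a :: real
  assumes "a < -1"
  shows "summable (\<lambda>n. real (Suc n) powr a)"
  using summable_real_powr_iff[of a] assms by (subst summable_Suc_iff) simp

lemma powr_eq_mult_powr_diff_one:
  fixes z a :: complex
  assumes "z \<noteq> 0"
  shows "z powr a = z * z powr (a - 1)"
  using assms by (simp add: powr_diff)

lemma norm_of_nat_Suc_powr: "norm (of_nat (Suc n) powr z :: complex) = real (Suc n) powr Re z"
proof -
  have "norm (of_real (real (Suc n)) powr z :: complex) = real (Suc n) powr Re z"
    by (subst norm_powr_real_powr) (auto simp del: of_nat_Suc of_real_of_nat_eq)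
  then show ?thesis by (simp only: of_real_of_nat_eq)
qed

text \<open>The exponent in \<open>bound\<close> is below -1 on the whole half-plane, and uniformly
  so on closed discs inside it, so the Weierstrass M-test applies there. The case
  \<open>c = 1\<close> serves the Dirichlet series, \<open>c = 0\<close> the series for the
  integral.\<close>

lemma holomorphic_suminf_half_plane:
  fixes f :: "nat \<Rightarrow> complex \<Rightarrow> complex"
  assumes hol: "\<And>n. f n holomorphic_on {z. c < Re z}"
    and bound: "\<And>n z. c < Re z \<Longrightarrow> norm (f n z) \<le> real (Suc n) powr (c - 1 - Re z)"
  shows "(\<lambda>z. \<Sum>n. f n z) holomorphic_on {z. c < Re z}"
proof (rule holomorphic_uniform_sequence)
  show "open {z. c < Re z}" by (rule open_halfspace_Re_gt)
  show "(\<lambda>z. \<Sum>i<n. f i z) holomorphic_on {z. c < Re z}" for n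
    using hol by (intro holomorphic_intros) auto
next
  fix x assume x: "x \<in> {z. c < Re z}"
  \<comment> \<open>Half the distance to the boundary line: on the disc of radius \<open>d\<close>
    the exponent is then at most \<open>-1 - d\<close>.\<close>
  define d where "d = (Re x - c) / 2"
  have d: "d > 0" using x by (simp add: d_def)
  have re: "Re z \<ge> c + d" if "z \<in> cball x d" for z
  proof -
    have "\<bar>Re x - Re z\<bar> \<le> d"
      using that abs_Re_le_cmod[of "x - z"] by (simp add: dist_norm)
    then have "Re x - Re z \<le> d" by simp
    then show ?thesis by (simp add: d_def field_simps)
  qed
  have "uniform_limit (cball x d) (\<lambda>n z. \<Sum>i<n. f i z) (\<lambda>z. \<Sum>n. f n z) sequentially"
  proof (rule Weierstrass_m_test)
    show "summable (\<lambda>n. real (Suc n) powr (-1 - d))" using d by (intro summable_Suc_powr) simp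
    fix n z assume z: "z \<in> cball x d"
    have "norm (f n z) \<le> real (Suc n) powr (c - 1 - Re z)"
      using re[OF z] d by (intro bound) simp
    also have "\<dots> \<le> real (Suc n) powr (-1 - d)"
      using re[OF z] by (intro powr_mono) auto
    finally show "norm (f n z) \<le> real (Suc n) powr (-1 - d)" .
  qed
  moreover have "cball x d \<subseteq> {z. c < Re z}" using re d by force
  ultimately show "\<exists>d>0. cball x d \<subseteq> {z. c < Re z} \<and>
      uniform_limit (cball x d) (\<lambda>n z. \<Sum>i<n. f i z) (\<lambda>z. \<Sum>n. f n z) sequentially"
    using d by blast
qed

lemma dirichlet_zeta_sums:
  assumes "1 < Re s"
  shows "(\<lambda>n. of_nat (Suc n) powr (- s)) sums dirichlet_zeta s"
proof -
  have "summable (\<lambda>n. of_nat (Suc n) powr (- s) :: complex)"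
    by (rule summable_norm_cancel, unfold norm_of_nat_Suc_powr, rule summable_Suc_powr) (use assms in simp)
  then show ?thesis unfolding dirichlet_zeta_def by (rule summable_sums)
qed

lemma holomorphic_dirichlet_zeta: "dirichlet_zeta holomorphic_on {z. 1 < Re z}"
  unfolding dirichlet_zeta_def
  by (rule holomorphic_suminf_half_plane)
     (auto intro!: holomorphic_intros simp: norm_of_nat_Suc_powr simp del: of_nat_Suc)

section \<open>The integral as a series\<close>

text \<open>Only the piece whose interval contains \<open>x\<close> survives, so both claims concern
  a series with at most one nonzero term.\<close>

lemma frac_floor_integrand_eq_suminf:
  "indicator {0<..} x *\<^sub>R frac_floor_integrand s x = (\<Sum>n. frac_floor_piece s n x)"
  and summable_norm_frac_floor_piece: "summable (\<lambda>n. norm (frac_floor_piece s n x))"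
proof -
  have piece_0: "frac_floor_piece s n x = 0" if "int (Suc n) \<noteq> \<lfloor>x\<rfloor>" for n
  proof -
    have "x \<notin> {real (Suc n)..<real (Suc n) + 1}"
      using that floor_unique[of "int (Suc n)" x] by auto
    then show ?thesis by (simp add: frac_floor_piece_def)
  qed
  have "(indicator {0<..} x *\<^sub>R frac_floor_integrand s x = (\<Sum>n. frac_floor_piece s n x)) \<and>
    summable (\<lambda>n. norm (frac_floor_piece s n x))"
  proof (cases "x < 1")
    case True
    have "frac_floor_piece s n x = 0" for n
      using True by (simp add: frac_floor_piece_def indicator_def)
    moreover have "indicator {0<..} x *\<^sub>R frac_floor_integrand s x = 0"
    proof (cases "x > 0")
      case True
      then have "\<lfloor>x\<rfloor> = 0" using \<open>x < 1\<close> by (intro floor_unique) auto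
      then show ?thesis by (simp add: frac_floor_integrand_def)
    qed simp
    ultimately show ?thesis by simp
  next
    case False
    define m where "m = nat \<lfloor>x\<rfloor> - 1"
    have m: "int (Suc m) = \<lfloor>x\<rfloor>" using False unfolding m_def by linarith
    define N where "N = real (Suc m)"
    have N: "of_int \<lfloor>x\<rfloor> = N" unfolding N_def m[symmetric] by simp
    have mem: "x \<in> {N..<N + 1}" unfolding N[symmetric] by auto
    have "(\<lambda>n. frac_floor_piece s n x) sums frac_floor_piece s m x"
      using sums_finite[of "{m}" "\<lambda>n. frac_floor_piece s n x"] piece_0 m by force
    then have suminf: "(\<Sum>n. frac_floor_piece s n x) = frac_floor_piece s m x"
      by (simp add: sums_iff)
    have summable: "summable (\<lambda>n. norm (frac_floor_piece s n x))"
      by (rule summable_finite[of "{m}"]) (use piece_0 m in force)+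
    have frac: "frac x = x - N" by (simp add: frac_def N)
    have denom: "x\<^sup>2 - N\<^sup>2 - (x - N) * N = (x - N) * x"
      by (simp add: algebra_simps power2_eq_square)
    have powr: "of_real x powr (- s - 1) = of_real x * (of_real x powr (- s - 2) :: complex)"
      using False powr_eq_mult_powr_diff_one[of "of_real x" "- s - 1"] by (simp add: diff_diff_eq)
    \<comment> \<open>At an integer \<open>x\<close> the left side is \<open>0 / 0 = 0\<close> and
      the factor \<open>x - N\<close> on the right vanishes too, so the equality holds at every
      point and not just almost everywhere.\<close>
    have "frac_floor_integrand s x = of_real (N * (x - N)) * of_real x powr (- s - 2)"
    proof (cases "frac x = 0")
      case True
      then show ?thesis using frac by (simp add: frac_floor_integrand_def)
    next
      case nonzero: False
      then show ?thesis
        using False unfolding frac_floor_integrand_def N frac denom powr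
        by (simp add: power2_eq_square)
    qed
    then have "indicator {0<..} x *\<^sub>R frac_floor_integrand s x = frac_floor_piece s m x"
      using False mem unfolding frac_floor_piece_def N_def[symmetric] by simp
    with suminf summable show ?thesis by simp
  qed
  then show "indicator {0<..} x *\<^sub>R frac_floor_integrand s x = (\<Sum>n. frac_floor_piece s n x)"
    and "summable (\<lambda>n. norm (frac_floor_piece s n x))" by blast+
qed

lemma has_bochner_integral_frac_floor_piece:
  assumes "s \<noteq> 0" "s \<noteq> -1"
  shows "has_bochner_integral lborel (frac_floor_piece s n) (frac_floor_term s n)"
proof -
  define N where "N = real (Suc n)"
  have N: "N > 0" by (simp add: N_def)
  define f where "f x = of_real (N * (x - N)) * (of_real x powr (- s - 2) :: complex)" for x
  \<comment> \<open>An antiderivative of \<open>f\<close> along the positive axis, found termwise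
    after expanding \<open>N * (x - N)\<close>. The excluded values 0 and -1 of \<open>s\<close> are
    the zeros of its denominators.\<close>
  define G where "G z = of_real N * (of_real N * z powr (- s - 1) / (s + 1) - z powr (- s) / s)" for z
  have s1: "s + 1 \<noteq> 0" using assms(2) by (simp add: eq_neg_iff_add_eq_0)
  have "((\<lambda>x. G (of_real x)) has_vector_derivative f x) (at x within {N..N + 1})"
    if "N \<le> x" "x \<le> N + 1" for x
  proof -
    have x: "x > 0" using that N by simp
    then have notin: "complex_of_real x \<notin> \<real>\<^sub>\<le>\<^sub>0" by simp
    have powr: "of_real x powr (- s - 1) = of_real x * (of_real x powr (- s - 2) :: complex)"
      using x powr_eq_mult_powr_diff_one[of "of_real x" "- s - 1"] by (simp add: diff_diff_eq)
    have "(G has_field_derivative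
        of_real N * (of_real N * ((- s - 1) * of_real x powr (- s - 1 - 1)) / (s + 1)
          - (- s * of_real x powr (- s - 1)) / s)) (at (of_real x))"
      unfolding G_def
      by (intro DERIV_cmult DERIV_diff DERIV_cdivide has_field_derivative_powr notin)
    also have "of_real N * (of_real N * ((- s - 1) * of_real x powr (- s - 1 - 1)) / (s + 1)
          - (- s * of_real x powr (- s - 1)) / s) = f x"
    proof -
      have "of_real N * ((- s - 1) * p) / (s + 1) = - (of_real N * p)" for p :: complex
        by (subst nonzero_divide_eq_eq[OF s1]) (simp add: algebra_simps)
      moreover have "- s - 1 - 1 = - s - 2" by simp
      ultimately show ?thesis using assms(1) by (simp only: f_def powr) (simp add: algebra_simps)
    qed
    finally have "(G has_field_derivative f x) (at (of_real x))" .
    then show ?thesis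
      by (rule has_vector_derivative_real_field)
  qed
  moreover have "continuous_on {N..N + 1} f"
    unfolding f_def using N by (intro continuous_intros) (auto simp: complex_nonpos_Reals_iff)
  ultimately have "has_bochner_integral lborel (\<lambda>x. indicator {N..N + 1} x *\<^sub>R f x)
      (G (of_real (N + 1)) - G (of_real N))"
    by (intro has_bochner_integral_FTC_Icc) auto
  also have "has_bochner_integral lborel (\<lambda>x. indicator {N..N + 1} x *\<^sub>R f x)
      (G (of_real (N + 1)) - G (of_real N)) \<longleftrightarrow>
    has_bochner_integral lborel (frac_floor_piece s n) (G (of_real (N + 1)) - G (of_real N))"
  \<comment> \<open>The fundamental theorem needs the closed interval, the piece uses the half-open
    one; they differ only at \<open>N + 1\<close>.\<close>
  proof (rule has_bochner_integral_cong_AE)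
    show "(\<lambda>x. indicator {N..N + 1} x *\<^sub>R f x) \<in> borel_measurable lborel"
      unfolding f_def by measurable
    show "frac_floor_piece s n \<in> borel_measurable lborel"
      unfolding frac_floor_piece_def by measurable
    show "AE x in lborel. indicator {N..N + 1} x *\<^sub>R f x = frac_floor_piece s n x"
      using AE_lborel_singleton[of "N + 1"]
    proof eventually_elim
      case (elim x)
      then have "x \<in> {N..N + 1} \<longleftrightarrow> x \<in> {N..<N + 1}" by auto
      then show ?case by (simp add: frac_floor_piece_def f_def N_def indicator_def)
    qed
  qed
  also have "G (of_real (N + 1)) - G (of_real N) = frac_floor_term s n"
  proof -
    have "of_real N = (of_nat (Suc n) :: complex)" "of_real (N + 1) = (of_nat (Suc (Suc n)) :: complex)"
      by (simp_all add: N_def)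
    then show ?thesis
      by (simp only: G_def frac_floor_term_def diff_divide_distrib right_diff_distrib) (simp only: algebra_simps)
  qed
  finally show ?thesis .
qed

text \<open>On an interval of length one, \<open>x - N\<close> is at most 1 and the decreasing power
  of \<open>x\<close> is largest at \<open>N\<close>; the factor \<open>N\<close> raises the
  exponent by one.\<close>

lemma integral_norm_frac_floor_piece_le:
  assumes "0 < Re s"
  shows "(\<integral>x. norm (frac_floor_piece s n x) \<partial>lborel) \<le> real (Suc n) powr (- Re s - 1)"
proof -
  define N where "N = real (Suc n)"
  have N: "N > 0" by (simp add: N_def)
  have ne: "s \<noteq> 0" "s \<noteq> -1" using assms by auto
  have "(\<integral>x. norm (frac_floor_piece s n x) \<partial>lborel) \<le>
      (\<integral>x. indicator {N..<N + 1} x *\<^sub>R (N powr (- Re s - 1)) \<partial>lborel)"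
  proof (rule integral_mono)
    show "integrable lborel (\<lambda>x. norm (frac_floor_piece s n x))"
      using has_bochner_integral_frac_floor_piece[OF ne] by (auto simp: has_bochner_integral_iff)
    show "integrable lborel (\<lambda>x. indicator {N..<N + 1} x *\<^sub>R (N powr (- Re s - 1)))"
      by (intro integrable_scaleR_left integrable_real_indicator) auto
    fix x :: real
    show "norm (frac_floor_piece s n x) \<le> indicator {N..<N + 1} x *\<^sub>R (N powr (- Re s - 1))"
    proof (cases "x \<in> {N..<N + 1}")
      case True
      then have x: "N \<le> x" "x < N + 1" by auto
      have "norm (frac_floor_piece s n x) = (N * (x - N)) * x powr (- Re s - 2)"
        using True x N unfolding frac_floor_piece_def N_def[symmetric]
        by (simp add: norm_mult norm_powr_real_powr del: of_real_mult of_real_diff)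
      also have "\<dots> \<le> (N * 1) * N powr (- Re s - 2)"
        using x N assms by (intro mult_mono powr_mono2') auto
      also have "\<dots> = N powr (- Re s - 1)"
        using N by (simp add: powr_diff power2_eq_square)
      finally show ?thesis using True by simp
    qed (simp add: frac_floor_piece_def N_def)
  qed
  also have "\<dots> = N powr (- Re s - 1)" by simp
  finally show ?thesis by (simp only: N_def)
qed

text \<open>The L1 norms of the pieces are summable, which yields integrability of the sum and
  allows integration term by term.\<close>

lemma frac_floor_integrand_integral:
  assumes "0 < Re s"
  shows set_integrable_frac_floor_integrand: "set_integrable lborel {0<..} (frac_floor_integrand s)"
    and frac_floor_term_sums: "frac_floor_term s sums (LBINT x:{0<..}. frac_floor_integrand s x)"
proof -
  have ne: "s \<noteq> 0" "s \<noteq> -1" using assms by auto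
  note piece = has_bochner_integral_frac_floor_piece[OF ne]
  have int: "integrable lborel (frac_floor_piece s n)" for n
    using piece by (auto simp: has_bochner_integral_iff)
  have AE: "AE x in lborel. summable (\<lambda>n. norm (frac_floor_piece s n x))"
    by (simp add: summable_norm_frac_floor_piece)
  have sm: "summable (\<lambda>n. \<integral>x. norm (frac_floor_piece s n x) \<partial>lborel)"
  proof (rule summable_comparison_test')
    show "summable (\<lambda>n. real (Suc n) powr (- Re s - 1))"
      using assms by (intro summable_Suc_powr) simp
  qed (use integral_norm_frac_floor_piece_le[OF assms] in simp)
  show "set_integrable lborel {0<..} (frac_floor_integrand s)"
    unfolding set_integrable_def frac_floor_integrand_eq_suminf
    by (rule integrable_suminf[OF int AE sm])
  show "frac_floor_term s sums (LBINT x:{0<..}. frac_floor_integrand s x)"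
    using sums_integral[OF int AE sm]
    unfolding set_lebesgue_integral_def frac_floor_integrand_eq_suminf
      has_bochner_integral_integral_eq[OF piece] .
qed

section \<open>Holomorphy, and evaluation for \<open>Re s > 1\<close>\<close>

text \<open>The bound on the L1 norm of a piece also bounds its integral, in the form required with
  \<open>c = 0\<close>.\<close>

lemma holomorphic_frac_floor_integral:
  "(\<lambda>s. LBINT x:{0<..}. frac_floor_integrand s x) holomorphic_on {s. 0 < Re s}"
proof -
  have "(\<lambda>s. \<Sum>n. frac_floor_term s n) holomorphic_on {s. 0 < Re s}"
  proof (rule holomorphic_suminf_half_plane)
    show "(\<lambda>s. frac_floor_term s n) holomorphic_on {s. 0 < Re s}" for n
      unfolding frac_floor_term_def
      by (intro holomorphic_intros) (auto simp: complex_eq_iff)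
    fix n and s :: complex assume s: "0 < Re s"
    then have ne: "s \<noteq> 0" "s \<noteq> -1" by auto
    have "norm (frac_floor_term s n) \<le> (\<integral>x. norm (frac_floor_piece s n x) \<partial>lborel)"
      using has_bochner_integral_frac_floor_piece[OF ne, of n]
        integral_norm_bound[of lborel "frac_floor_piece s n"]
      by (simp add: has_bochner_integral_integral_eq)
    also have "\<dots> \<le> real (Suc n) powr (- Re s - 1)"
      by (rule integral_norm_frac_floor_piece_le[OF s])
    also have "- Re s - 1 = 0 - 1 - Re s" by simp
    finally show "norm (frac_floor_term s n) \<le> real (Suc n) powr (0 - 1 - Re s)" .
  qed
  then show ?thesis
    by (rule holomorphic_transform) (use frac_floor_term_sums in \<open>auto simp: sums_iff\<close>)
qed

text \<open>For \<open>Re s > 1\<close> both Dirichlet series converge and \<open>?a\<close> tends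
  to 0, so each term can be split into a telescoping difference and shifted Dirichlet terms.\<close>

lemma frac_floor_integral_eq_dirichlet:
  assumes s: "1 < Re s"
  shows "(LBINT x:{0<..}. frac_floor_integrand s x) =
    1 / (s * (s + 1)) * (s * dirichlet_zeta (s + 1) + (1 - s) * dirichlet_zeta s)"
proof -
  let ?a = "\<lambda>n. of_nat (Suc n) powr (1 - s) :: complex"
  have ne: "s \<noteq> 0" "s + 1 \<noteq> 0" using s by (auto simp: complex_eq_iff)
  have powr1: "of_nat (Suc n) powr (1 - s) = of_nat (Suc n) * (of_nat (Suc n) powr (- s) :: complex)" for n
    using powr_eq_mult_powr_diff_one[of "of_nat (Suc n)" "1 - s"] by (simp del: of_nat_Suc)
  have powr2: "of_nat (Suc n) powr (- s) = of_nat (Suc n) * (of_nat (Suc n) powr (- s - 1) :: complex)" for n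
    by (rule powr_eq_mult_powr_diff_one) (simp del: of_nat_Suc)
  have "?a \<longlonglongrightarrow> 0"
  proof (rule tendsto_norm_zero_cancel)
    have "filterlim (\<lambda>n. real (Suc n)) at_top sequentially"
      by (rule filterlim_compose[OF filterlim_real_sequentially filterlim_Suc])
    then have "(\<lambda>n. real (Suc n) powr (1 - Re s)) \<longlonglongrightarrow> 0"
      using s by (intro tendsto_neg_powr) auto
    then show "(\<lambda>n. norm (?a n)) \<longlonglongrightarrow> 0"
      unfolding norm_of_nat_Suc_powr by simp
  qed
  then have tel: "(\<lambda>n. ?a n - ?a (Suc n)) sums 1"
    using telescope_sums'[of ?a 0] by simp
  \<comment> \<open>The shifted series begins at 2; the missing first term is 1.\<close>
  have b: "(\<lambda>n. of_nat (Suc (Suc n)) powr (- s)) sums (dirichlet_zeta s - 1)"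
    using dirichlet_zeta_sums[OF s]
    by (subst sums_Suc_iff) (simp del: of_nat_Suc add: of_nat_Suc[of 0])
  have "1 < Re (s + 1)" using s by simp
  from dirichlet_zeta_sums[OF this]
  have c: "(\<lambda>n. of_nat (Suc (Suc n)) powr (- s - 1)) sums (dirichlet_zeta (s + 1) - 1)"
    by (subst sums_Suc_iff) (simp del: of_nat_Suc add: of_nat_Suc[of 0])
  \<comment> \<open>With \<open>M = Suc (Suc n)\<close>, the factors \<open>M - 1\<close> and
    \<open>(M - 1)^2 = M^2 - 2 * M + 1\<close> are absorbed into the powers of \<open>M\<close>;
    this produces the coefficients 1, 2 and -1.\<close>
  have "(\<lambda>n. ((?a n - ?a (Suc n)) + of_nat (Suc (Suc n)) powr (- s)) / s -
      ((?a n - ?a (Suc n)) + 2 * of_nat (Suc (Suc n)) powr (- s)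
        - of_nat (Suc (Suc n)) powr (- s - 1)) / (s + 1))
    sums ((1 + (dirichlet_zeta s - 1)) / s -
      (1 + 2 * (dirichlet_zeta s - 1) - (dirichlet_zeta (s + 1) - 1)) / (s + 1))"
    by (intro sums_diff sums_add sums_divide sums_mult tel b c)
  moreover have "((?a n - ?a (Suc n)) + of_nat (Suc (Suc n)) powr (- s)) / s -
      ((?a n - ?a (Suc n)) + 2 * of_nat (Suc (Suc n)) powr (- s)
        - of_nat (Suc (Suc n)) powr (- s - 1)) / (s + 1) = frac_floor_term s n" for n
  proof -
    \<comment> \<open>Once every power is a multiple of \<open>u\<close> or \<open>v\<close>, the
      claim reduces to polynomial identities in \<open>N\<close>, \<open>u\<close>,
      \<open>v\<close>.\<close>
    define N u v :: complex where "N = of_nat (Suc n)" and "u = of_nat (Suc n) powr (- s - 1)"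
      and "v = of_nat (Suc (Suc n)) powr (- s - 1)"
    have N': "of_nat (Suc (Suc n)) = N + 1" by (simp add: N_def)
    have num: "N * (N * u) - (N + 1) * ((N + 1) * v) + (N + 1) * v = N * (N * u - (N + 1) * v)"
      and num': "N * (N * u) - (N + 1) * ((N + 1) * v) + 2 * ((N + 1) * v) - v = N * (N * (u - v))"
      by (simp_all add: algebra_simps)
    show ?thesis
      unfolding frac_floor_term_def powr1 powr2
      unfolding u_def[symmetric] v_def[symmetric]
      unfolding N' N_def[symmetric] num num' by (simp add: right_diff_distrib)
  qed
  ultimately have "(LBINT x:{0<..}. frac_floor_integrand s x) = (1 + (dirichlet_zeta s - 1)) / s -
      (1 + 2 * (dirichlet_zeta s - 1) - (dirichlet_zeta (s + 1) - 1)) / (s + 1)"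
    using frac_floor_term_sums[of s] s by (simp add: sums_iff)
  also have "\<dots> = 1 / (s * (s + 1)) * (s * dirichlet_zeta (s + 1) + (1 - s) * dirichlet_zeta s)"
    using ne by (simp add: divide_simps) algebra
  finally show ?thesis .
qed

section \<open>Analytic continuation of zeta\<close>

text \<open>Makes the definite description usable: by the identity theorem any two admissible
  continuations agree at \<open>s\<close>, so exhibiting one suffices.\<close>

lemma zeta_eqI:
  assumes hol: "f holomorphic_on ({z. c < Re z} - {1})"
    and eq: "\<And>z. c < Re z \<Longrightarrow> 1 < Re z \<Longrightarrow> f z = dirichlet_zeta z"
    and s: "c < Re s" "s \<noteq> 1"
  shows "zeta s = f s"
  unfolding zeta_def dirichlet_zeta_def[symmetric]
proof (rule the_equality)
  show "\<exists>c g. c < Re s \<and> g holomorphic_on ({z. c < Re z} - {1}) \<and>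
      (\<forall>z. c < Re z \<longrightarrow> 1 < Re z \<longrightarrow> g z = dirichlet_zeta z) \<and> f s = g s"
    using assms by blast
next
  fix v
  assume "\<exists>c g. c < Re s \<and> g holomorphic_on ({z. c < Re z} - {1}) \<and>
      (\<forall>z. c < Re z \<longrightarrow> 1 < Re z \<longrightarrow> g z = dirichlet_zeta z) \<and> v = g s"
  then obtain c' g where g: "c' < Re s" "g holomorphic_on ({z. c' < Re z} - {1})"
    "\<And>z. c' < Re z \<Longrightarrow> 1 < Re z \<Longrightarrow> g z = dirichlet_zeta z" "v = g s"
    by blast
  \<comment> \<open>The candidates may live on different half-planes; they are compared on the
    intersection, which contains \<open>s\<close> and stays connected without the point 1.\<close>
  define m where "m = max c c'"
  have "g s = f s"
  proof (rule analytic_continuation_open[where f = g and g = f])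
    show "open {z. max m 1 < Re z}" by (rule open_halfspace_Re_gt)
    show "open ({z. m < Re z} - {1})" by (intro open_delete open_halfspace_Re_gt)
    have "complex_of_real (max m 1 + 1) \<in> {z. max m 1 < Re z}" by (simp add: max_def)
    then show "{z. max m 1 < Re z} \<noteq> {}" by blast
    show "connected ({z. m < Re z} - {1})"
      by (intro connected_open_delete open_halfspace_Re_gt convex_connected convex_halfspace_Re_gt) simp
    show "{z. max m 1 < Re z} \<subseteq> {z. m < Re z} - {1}" by auto
    show "g holomorphic_on ({z. m < Re z} - {1})"
      by (rule holomorphic_on_subset[OF g(2)]) (auto simp: m_def)
    show "f holomorphic_on ({z. m < Re z} - {1})"
      by (rule holomorphic_on_subset[OF hol]) (auto simp: m_def)
    show "g z = f z" if "z \<in> {z. max m 1 < Re z}" for z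
      using that eq[of z] g(3)[of z] by (simp add: m_def)
    show "s \<in> {z. m < Re z} - {1}" using s g(1) by (simp add: m_def)
  qed
  then show "v = f s" using g(4) by simp
qed

lemma zeta_eq_dirichlet_zeta:
  assumes "1 < Re s"
  shows "zeta s = dirichlet_zeta s"
proof (rule zeta_eqI[where c = 1])
  show "dirichlet_zeta holomorphic_on ({z. 1 < Re z} - {1})"
    by (rule holomorphic_on_subset[OF holomorphic_dirichlet_zeta]) auto
qed (use assms in auto)

lemma frac_floor_integral_eq_zeta:
  assumes s: "0 < Re s" "s \<noteq> 1"
  shows "(LBINT x:{0<..}. frac_floor_integrand s x) =
    1 / (s * (s + 1)) * (s * zeta (s + 1) + (1 - s) * zeta s)"
proof -
  let ?F = "\<lambda>z. LBINT x:{0<..}. frac_floor_integrand z x"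
  \<comment> \<open>The claimed identity solved for \<open>zeta z\<close>. Since
    \<open>Re (z + 1) > 1\<close>, the shifted zeta value is given by its Dirichlet series, and the
    only zero of the denominator is the excluded point 1.\<close>
  define Z where "Z z = (z * (z + 1) * ?F z - z * dirichlet_zeta (z + 1)) / (1 - z)" for z
  have "dirichlet_zeta \<circ> (\<lambda>z. z + 1) holomorphic_on ({z. 0 < Re z} - {1})"
    by (rule holomorphic_on_compose_gen[OF _ holomorphic_dirichlet_zeta])
      (auto intro!: holomorphic_intros)
  then have shift: "(\<lambda>z. dirichlet_zeta (z + 1)) holomorphic_on ({z. 0 < Re z} - {1})"
    by (simp add: o_def)
  have "zeta s = Z s"
  proof (rule zeta_eqI[where c = 0])
    show "Z holomorphic_on ({z. 0 < Re z} - {1})"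
      unfolding Z_def
      by (intro holomorphic_intros shift holomorphic_on_subset[OF holomorphic_frac_floor_integral]) auto
    fix z :: complex assume z: "1 < Re z"
    then have "z \<noteq> 0" "z + 1 \<noteq> 0" "1 - z \<noteq> 0" by (auto simp: complex_eq_iff)
    then show "Z z = dirichlet_zeta z"
      unfolding Z_def frac_floor_integral_eq_dirichlet[OF z] by simp
  qed (use s in auto)
  moreover have "zeta (s + 1) = dirichlet_zeta (s + 1)"
    using s by (intro zeta_eq_dirichlet_zeta) simp
  moreover have "s \<noteq> 0" "s + 1 \<noteq> 0" "1 - s \<noteq> 0" using s by (auto simp: complex_eq_iff)
  ultimately show ?thesis unfolding Z_def by simp
qed

section \<open>The formula, with the pole as a limit\<close>

text \<open>At \<open>s = 1\<close> the product \<open>(1 - s) * zeta s\<close> involves the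
  unspecified value at the pole, so the formula is read there as a limit.\<close>

theorem theorem5:
  fixes s :: complex
  assumes "Re s > 0"
  shows "set_integrable lborel {0<..} (frac_floor_integrand s) \<and>
    (s \<noteq> 1 \<longrightarrow>
      (LBINT x:{0<..}. frac_floor_integrand s x) =
        1 / (s * (s + 1)) * (s * zeta (s + 1) + (1 - s) * zeta s)) \<and>
    (s = 1 \<longrightarrow>
      ((\<lambda>z. 1 / (z * (z + 1)) * (z * zeta (z + 1) + (1 - z) * zeta z)) \<longlongrightarrow>
        (LBINT x:{0<..}. frac_floor_integrand s x)) (at s))"
proof (intro conjI impI)
  show "set_integrable lborel {0<..} (frac_floor_integrand s)"
    by (rule set_integrable_frac_floor_integrand[OF assms])
  show "(LBINT x:{0<..}. frac_floor_integrand s x) =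
      1 / (s * (s + 1)) * (s * zeta (s + 1) + (1 - s) * zeta s)" if "s \<noteq> 1"
    by (rule frac_floor_integral_eq_zeta[OF assms that])
  assume s: "s = 1"
  \<comment> \<open>\<open>?F\<close> is continuous at 1 and equals the formula on a punctured
    neighbourhood, which gives the limit without knowing the residue of zeta.\<close>
  let ?F = "\<lambda>z. LBINT x:{0<..}. frac_floor_integrand z x"
  have open_half: "open {z. 0 < Re z}" by (rule open_halfspace_Re_gt)
  have "continuous_on {z. 0 < Re z} ?F"
    by (rule holomorphic_on_imp_continuous_on[OF holomorphic_frac_floor_integral])
  then have "isCont ?F s"
    using assms open_half by (simp add: continuous_on_eq_continuous_at)
  then have "(?F \<longlongrightarrow> ?F s) (at s)" by (simp add: isCont_def)
  moreover have "\<forall>\<^sub>F z in at s. z \<in> {z. 0 < Re z}"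
    by (rule eventually_at_in_open'[OF open_half]) (use assms in simp)
  then have "\<forall>\<^sub>F z in at s. ?F z = 1 / (z * (z + 1)) * (z * zeta (z + 1) + (1 - z) * zeta z)"
    using eventually_neq_at_within[of s s UNIV]
    by eventually_elim (use s in \<open>simp add: frac_floor_integral_eq_zeta\<close>)
  ultimately show "((\<lambda>z. 1 / (z * (z + 1)) * (z * zeta (z + 1) + (1 - z) * zeta z)) \<longlongrightarrow> ?F s) (at s)"
    by (rule Lim_transform_eventually)
qed

end
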